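(* Let $C = A+\mathrm{i} B\in\mathbb{C}^{n\times n}$, where $A, B\in\mathbb{C}^{n\times n}$ are Hermitian. Then the Crawford number $\chi(C)$ satisfies $$\chi(C) = \min\ \tfrac{1}{2}(u+w)\quad\text{subject to}\quad \tfrac{1}{2}(u-w)-\langle A,X\rangle=0,\quad v-\langle B,X\rangle=0,\quad \langle I_n,X\rangle=1,\quad X\succeq 0,\quad \begin{bmatrix} u & v \\ v & w \end{bmatrix}\succeq 0,$$ where the minimum is over all $n\times n$ complex Hermitian matrices $X$ and all real numbers $u,v,w$ satisfying the constraints.
   Context: The numerical range of $C\in\mathbb{C}^{n\times n}$ is $\mathcal{W}(C)=\{\mathbf{x}^*C\mathbf{x} : \mathbf{x}\in\mathbb{C}^n, \|\mathbf{x}\|=1\}\subset\mathbb{C}$, where $\|\mathbf{x}\|=\sqrt{\mathbf{x}^*\mathbf{x}}$. The Crawford number of $C$ is $\chi(C)=\min\{|z| : z\in\mathcal{W}(C)\}$. For Hermitian matrices $F,G$ of the same size, $\langle F,G\rangle=\mathrm{Tr}(FG)$ (a real number). $F\succeq 0$ means that $F$ is Hermitian positive semidefinite, and $I_n$ is the $n\times n$ identity matrix. Every $C\in\mathbb{C}^{n\times n}$ is uniquely of the form $A+\mathrm{i}B$ with $A,B$ Hermitian, namely $A=(C+C^* )/2$, $B=(C-C^* )/(2\mathrm{i})$. *)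

theory Defs
  imports "HOL-Analysis.Analysis"
begin

definition ctranspose :: "complex^'n^'m \<Rightarrow> complex^'m^'n"
  where "ctranspose F = map_matrix cnj (transpose F)"

definition hermitian :: "complex^'n^'n \<Rightarrow> bool"
  where "hermitian F \<longleftrightarrow> ctranspose F = F"

definition quad_form :: "complex^'n^'n \<Rightarrow> complex^'n \<Rightarrow> complex"
  where "quad_form F x = (\<Sum>i\<in>UNIV. cnj (x $ i) * (F *v x) $ i)"

definition psd :: "complex^'n^'n \<Rightarrow> bool"
  where "psd F \<longleftrightarrow> hermitian F \<and> (\<forall>x. quad_form F x \<in> \<real>\<^sub>\<ge>\<^sub>0)"

definition numerical_range :: "complex^'n^'n \<Rightarrow> complex set"
  where "numerical_range C = {quad_form C x | x. norm x = 1}"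

definition is_minimum :: "real \<Rightarrow> real set \<Rightarrow> bool"
  where "is_minimum m S \<longleftrightarrow> m \<in> S \<and> (\<forall>s\<in>S. m \<le> s)"

(* The minimum exists by compactness: crawford_number_is_minimum. *)
definition crawford_number :: "complex^'n^'n \<Rightarrow> real"
  where "crawford_number C = (THE m. is_minimum m (cmod ` numerical_range C))"

(* For Hermitian arguments the trace is real and taking the real part loses
   nothing: of_real_trace_inner. *)
definition trace_inner :: "complex^'n^'n \<Rightarrow> complex^'n^'n \<Rightarrow> real"
  where "trace_inner F G = Re (trace (F ** G))"

definition sym2 :: "real \<Rightarrow> real \<Rightarrow> real \<Rightarrow> complex^2^2"
  where "sym2 u v w =
    vector [vector [complex_of_real u, complex_of_real v],
            vector [complex_of_real v, complex_of_real w]]"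

lemma of_real_trace_inner:
  assumes "hermitian F" "hermitian G"
  shows "complex_of_real (trace_inner F G) = trace (F ** G)"
proof -
  have F: "cnj (F $ i $ j) = F $ j $ i" for i j
    using assms(1) by (simp add: hermitian_def ctranspose_def map_matrix_def transpose_def vec_eq_iff)
  have G: "cnj (G $ i $ j) = G $ j $ i" for i j
    using assms(2) by (simp add: hermitian_def ctranspose_def map_matrix_def transpose_def vec_eq_iff)
  have "cnj (trace (F ** G)) = trace (G ** F)"
    by (simp add: trace_def matrix_matrix_mult_def F G mult.commute)
  also have "\<dots> = trace (F ** G)"
    by (rule trace_mul_sym)
  finally have "trace (F ** G) \<in> \<real>"
    by (simp add: Reals_cnj_iff)
  then show ?thesis
    by (simp add: trace_inner_def)
qed

lemma crawford_number_is_minimum: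
  "is_minimum (crawford_number C) (cmod ` numerical_range C)"
proof -
  have "continuous_on (sphere 0 1) (\<lambda>x. cmod (quad_form C x))"
    unfolding quad_form_def matrix_vector_mult_def by (simp, intro continuous_intros)
  moreover have "axis undefined 1 \<in> (sphere 0 1 :: (complex^'a) set)"
    by (simp add: norm_axis_1)
  ultimately obtain x where x: "x \<in> sphere 0 1"
      and le: "\<forall>y\<in>sphere 0 1. cmod (quad_form C x) \<le> cmod (quad_form C y)"
    using continuous_attains_inf[OF compact_sphere] by blast
  have "is_minimum (cmod (quad_form C x)) (cmod ` numerical_range C)"
    using x le by (auto simp: is_minimum_def numerical_range_def)
  then show ?thesis
    unfolding crawford_number_def
    by (rule theI) (meson is_minimum_def antisym \<open>is_minimum (cmod (quad_form C x)) _\<close>)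
qed

end

theory Submission
  imports Defs
begin

text \<open>
  For a density matrix \<open>X\<close> (positive semidefinite of trace one) the numbers \<open>\<langle>A,X\<rangle>\<close> and
  \<open>\<langle>B,X\<rangle>\<close> are the real and imaginary parts of \<open>Tr(CX)\<close>.  The semidefinite program
  minimises \<open>|Tr(CX)|\<close> over all such \<open>X\<close>: the \<open>2\<times>2\<close> matrix has mean diagonal entry
  \<open>m = (u + w)/2\<close> and eigenvalues \<open>m \<plusminus> |(u - w)/2 + \<i>v|\<close>, so its semidefiniteness says
  exactly that \<open>m\<close> is an upper bound for \<open>|Tr(CX)|\<close> (lemma \<open>psd_sym2_iff\<close>).

  It remains to see that \<open>Tr(CX)\<close> takes its values in the numerical range of \<open>C\<close> and attains
  all of them.  A unit vector \<open>x\<close> gives the density matrix \<open>xx\<^sup>*\<close> with \<open>Tr(C xx\<^sup>*) = x\<^sup>* C x\<close>,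
  so every point of the numerical range occurs.  Conversely, a density matrix is a sum
  of rank-one matrices \<open>y y\<^sup>*\<close> (lemma \<open>psd_eq_sum_outer\<close>), which exhibits \<open>Tr(CX)\<close> as a convex
  combination, with weights \<open>\<parallel>y\<parallel>\<^sup>2\<close>, of points of the numerical range; by the
  Toeplitz--Hausdorff theorem (\<open>convex_numerical_range\<close>) that set is convex.

  The decomposition into rank-one matrices comes from symmetric Gaussian elimination, as in
  the Cholesky factorisation: the vectors \<open>y\<close> are the scaled pivot columns.
\<close>

section \<open>Sesquilinear forms and rank-one matrices\<close>

definition sesq_form :: "complex^'n^'n \<Rightarrow> complex^'n \<Rightarrow> complex^'n \<Rightarrow> complex"
  where "sesq_form F x y = (\<Sum>i\<in>UNIV. cnj (x $ i) * (F *v y) $ i)"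

lemma quad_form_eq_sesq_form: "quad_form F x = sesq_form F x x"
  by (simp add: quad_form_def sesq_form_def)

lemma sesq_form_simps:
  "sesq_form F (x + x') y = sesq_form F x y + sesq_form F x' y"
  "sesq_form F x (y + y') = sesq_form F x y + sesq_form F x y'"
  "sesq_form F (c *s x) y = cnj c * sesq_form F x y"
  "sesq_form F x (c *s y) = c * sesq_form F x y"
  by (simp_all add: sesq_form_def matrix_vector_right_distrib vector_scalar_commute
      algebra_simps sum.distrib sum_distrib_left)

lemma sesq_form_axis: "sesq_form F (axis i 1) y = (F *v y) $ i"
  by (simp add: sesq_form_def axis_def if_distrib[of cnj] if_distrib[of "\<lambda>c. c * _"]
      cong: if_cong)

lemma sesq_form_axis_axis: "sesq_form F (axis i 1) (axis j 1) = F $ i $ j"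
  unfolding sesq_form_axis
  by (simp add: matrix_vector_mult_def axis_def if_distrib[of "\<lambda>c. _ * c"] cong: if_cong)

lemma hermitian_entry: "hermitian F \<longleftrightarrow> (\<forall>i j. cnj (F $ i $ j) = F $ j $ i)"
  by (auto simp: hermitian_def ctranspose_def map_matrix_def transpose_def vec_eq_iff)

lemma sesq_form_hermitian:
  assumes "hermitian F"
  shows "sesq_form F y x = cnj (sesq_form F x y)"
proof -
  have "sesq_form F y x = (\<Sum>i\<in>UNIV. \<Sum>j\<in>UNIV. cnj (y $ i) * (F $ i $ j * x $ j))"
    by (simp add: sesq_form_def matrix_vector_mult_def sum_distrib_left)
  also have "\<dots> = (\<Sum>j\<in>UNIV. \<Sum>i\<in>UNIV. cnj (y $ i) * (F $ i $ j * x $ j))"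
    by (rule sum.swap)
  also have "\<dots> = cnj (sesq_form F x y)"
    using assms unfolding hermitian_entry
    by (simp add: sesq_form_def matrix_vector_mult_def sum_distrib_left mult.left_commute mult.commute)
  finally show ?thesis .
qed

lemma quad_form_scale: "quad_form F (c *s x) = of_real ((cmod c)\<^sup>2) * quad_form F x"
proof -
  have "quad_form F (c *s x) = (c * cnj c) * quad_form F x"
    unfolding quad_form_eq_sesq_form sesq_form_simps by (simp add: algebra_simps)
  then show ?thesis by (simp only: complex_norm_square[symmetric])
qed

lemma norm_vec_complex_square: "(norm (x :: complex^'n))\<^sup>2 = (\<Sum>i\<in>UNIV. (cmod (x $ i))\<^sup>2)"
  by (simp add: norm_vec_def L2_set_def sum_nonneg)

lemma norm_scale_vec: "norm (c *s x) = cmod c * norm (x :: complex^'n)"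
proof -
  have "(norm (c *s x))\<^sup>2 = (cmod c * norm x)\<^sup>2"
    by (simp add: norm_vec_complex_square power_mult_distrib norm_mult sum_distrib_left)
  then show ?thesis by (simp add: power2_eq_iff_nonneg)
qed

definition outer :: "complex^'n \<Rightarrow> complex^'n^'n"
  where "outer y = (\<chi> i j. y $ i * cnj (y $ j))"

lemma trace_mult_outer: "trace (F ** outer y) = quad_form F y"
  by (simp add: trace_def matrix_matrix_mult_def outer_def quad_form_def matrix_vector_mult_def
      sum_distrib_left algebra_simps)

lemma trace_outer: "trace (outer y) = of_real ((norm y)\<^sup>2)"
  unfolding norm_vec_complex_square of_real_sum complex_norm_square
  by (simp add: trace_def outer_def)

lemma hermitian_outer: "hermitian (outer y)"
  by (simp add: hermitian_entry outer_def mult.commute)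

lemma quad_form_outer:
  "quad_form (outer y) x = of_real ((cmod (\<Sum>i\<in>UNIV. cnj (y $ i) * x $ i))\<^sup>2)"
proof -
  have "quad_form (outer y) x = (\<Sum>i\<in>UNIV. cnj (x $ i) * y $ i) * (\<Sum>j\<in>UNIV. cnj (y $ j) * x $ j)"
    by (simp add: outer_def quad_form_def matrix_vector_mult_def sum_product sum_distrib_left
        algebra_simps)
  also have "(\<Sum>i\<in>UNIV. cnj (x $ i) * y $ i) = cnj (\<Sum>j\<in>UNIV. cnj (y $ j) * x $ j)"
    by (simp add: mult.commute)
  finally show ?thesis by (simp only: complex_norm_square mult.commute)
qed

lemma psd_outer: "psd (outer y)"
  by (auto simp: psd_def hermitian_outer quad_form_outer)

section \<open>Positive semidefinite matrices as sums of rank-one matrices\<close>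

text \<open>
  Semidefiniteness at \<open>x - t s y\<close>, where \<open>s\<close> is the value of the form at \<open>(y, x)\<close>, gives a
  real quadratic in \<open>t\<close> that is nowhere negative.  The form may be degenerate, so \<open>y\<close> may
  be a nonzero isotropic vector; then the quadratic is affine in \<open>t\<close> and forces \<open>s = 0\<close>.
\<close>

lemma psd_Cauchy_Schwarz:
  assumes "psd F"
  shows "(cmod (sesq_form F y x))\<^sup>2 \<le> Re (quad_form F y) * Re (quad_form F x)"
proof -
  define s where "s = sesq_form F y x"
  define p where "p = Re (quad_form F x)"
  define q where "q = Re (quad_form F y)"
  have herm: "hermitian F" and nn: "\<And>z. quad_form F z \<in> \<real>\<^sub>\<ge>\<^sub>0"
    using assms by (auto simp: psd_def)
  have p: "sesq_form F x x = of_real p" and q: "sesq_form F y y = of_real q"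
    using nn unfolding quad_form_eq_sesq_form[symmetric] p_def q_def
    by (auto simp: complex_nonneg_Reals_iff complex_eq_iff)
  have p0: "0 \<le> p" and q0: "0 \<le> q"
    using nn by (auto simp: complex_nonneg_Reals_iff p_def q_def)
  have s': "sesq_form F x y = cnj s"
    unfolding s_def by (rule sesq_form_hermitian[OF herm])
  have *: "0 \<le> p - 2 * t * (cmod s)\<^sup>2 + t\<^sup>2 * (cmod s)\<^sup>2 * q" for t
  proof -
    have "quad_form F (x + (- (of_real t * s)) *s y)
        = of_real p - 2 * of_real t * (s * cnj s) + (of_real t)\<^sup>2 * (s * cnj s) * of_real q"
      unfolding quad_form_eq_sesq_form sesq_form_simps p q s' s_def[symmetric]
      by (simp add: algebra_simps power2_eq_square)
    also have "\<dots> = of_real (p - 2 * t * (cmod s)\<^sup>2 + t\<^sup>2 * (cmod s)\<^sup>2 * q)"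
      unfolding complex_norm_square[symmetric] by simp
    finally show ?thesis
      using nn[of "x + (- (of_real t * s)) *s y"]
      by (simp only: nonneg_Reals_of_real_iff)
  qed
  have "(cmod s)\<^sup>2 \<le> q * p"
  proof (cases "q = 0")
    case True
    have "s = 0"
    proof (rule ccontr)
      assume "s \<noteq> 0"
      \<comment> \<open>This \<open>t\<close> makes the affine function equal to \<open>-1\<close>.\<close>
      then have "2 * ((p + 1) / (2 * (cmod s)\<^sup>2)) * (cmod s)\<^sup>2 = p + 1" by simp
      then show False
        using *[of "(p + 1) / (2 * (cmod s)\<^sup>2)"] True by simp
    qed
    then show ?thesis using p0 q0 by simp
  next
    case False
    \<comment> \<open>\<open>t = 1/q\<close> minimises the quadratic.\<close>
    have "q * (p - 2 * (1 / q) * S + (1 / q)\<^sup>2 * S * q) = q * p - S" for S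
      using False by (simp add: power2_eq_square right_diff_distrib distrib_left)
    with mult_nonneg_nonneg[OF q0 *[of "1 / q"]] show ?thesis by simp
  qed
  then show ?thesis by (simp add: s_def p_def q_def)
qed

text \<open>
  One step of Cholesky elimination: \<open>y\<close> is the \<open>i\<close>-th column divided by the root of the
  pivot \<open>d\<close>, and the Cauchy--Schwarz inequality against the \<open>i\<close>-th unit vector says that the
  Schur complement is still semidefinite.  The last property ensures that rows
  eliminated earlier stay zero.
\<close>

lemma psd_eliminate_index:
  fixes F :: "complex^'n^'n"
  assumes F: "psd F"
  obtains y where "psd (F - outer y)" "\<And>j. (F - outer y) $ i $ j = 0"
    "\<And>k. (\<And>j. F $ k $ j = 0) \<Longrightarrow> y $ k = 0"
proof
  define d where "d = Re (F $ i $ i)"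
  \<comment> \<open>For a zero pivot, division by zero makes \<open>y = 0\<close>; this is the right choice because then
      the whole row of \<open>F\<close> vanishes by \<open>CS\<close> below.\<close>
  define y where "y = (\<chi> k. F $ k $ i / of_real (sqrt d))"
  have herm: "hermitian F" and nn: "\<And>z. quad_form F z \<in> \<real>\<^sub>\<ge>\<^sub>0"
    using F by (auto simp: psd_def)
  have cnjF: "cnj (F $ j $ k) = F $ k $ j" for j k
    using herm by (simp add: hermitian_entry)
  have q: "quad_form F (axis i 1) = F $ i $ i"
    by (simp add: quad_form_eq_sesq_form sesq_form_axis_axis)
  have d: "F $ i $ i = of_real d" "0 \<le> d"
    using nn[of "axis i 1"] unfolding q d_def
    by (auto simp: complex_nonneg_Reals_iff complex_eq_iff)
  have CS: "(cmod ((F *v x) $ i))\<^sup>2 \<le> d * Re (quad_form F x)" for x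
    using psd_Cauchy_Schwarz[OF F, of "axis i 1" x] by (simp add: sesq_form_axis q d)
  show "y $ k = 0" if "\<And>j. F $ k $ j = 0" for k
    using that by (simp add: y_def)
  show "(F - outer y) $ i $ j = 0" for j
  proof (cases "d = 0")
    case True
    have "F $ i $ j = 0"
      using CS[of "axis j 1"] True sesq_form_axis[of F i "axis j 1"]
      by (simp add: sesq_form_axis_axis)
    then show ?thesis by (simp add: outer_def y_def True)
  next
    case False
    then show ?thesis
      using d by (simp add: outer_def y_def cnjF flip: of_real_mult)
  qed
  have y_inner: "(\<Sum>k\<in>UNIV. cnj (y $ k) * x $ k) = (F *v x) $ i / of_real (sqrt d)" for x
    by (simp add: y_def cnjF matrix_vector_mult_def sum_divide_distrib)
  have diff: "quad_form (F - outer y) x = quad_form F x - quad_form (outer y) x" for x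
    by (simp add: quad_form_def matrix_vector_mult_diff_rdistrib algebra_simps sum_subtractf)
  show "psd (F - outer y)"
    unfolding psd_def
  proof (intro conjI allI)
    show "hermitian (F - outer y)"
      using herm hermitian_outer[of y] by (simp add: hermitian_entry)
    show "quad_form (F - outer y) x \<in> \<real>\<^sub>\<ge>\<^sub>0" for x
    proof -
      have "(cmod ((F *v x) $ i / of_real (sqrt d)))\<^sup>2 = (cmod ((F *v x) $ i))\<^sup>2 / d"
        using d by (simp add: norm_divide power_divide)
      also have "\<dots> \<le> Re (quad_form F x)"
        using CS[of x] d nn[of x]
        by (cases "d = 0") (auto simp: field_simps complex_nonneg_Reals_iff)
      finally show ?thesis
        using nn[of x] unfolding diff quad_form_outer y_inner
        by (simp add: complex_nonneg_Reals_iff)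
    qed
  qed
qed

lemma psd_eq_sum_outer:
  fixes X :: "complex^'n^'n"
  assumes "psd X"
  obtains y :: "'n \<Rightarrow> complex^'n" where "X = (\<Sum>k\<in>UNIV. outer (y k))"
proof -
  have "\<exists>y. psd (X - (\<Sum>k\<in>S. outer (y k))) \<and>
      (\<forall>i\<in>S. \<forall>j. (X - (\<Sum>k\<in>S. outer (y k))) $ i $ j = 0)"
    if "finite S" for S :: "'n set"
    using that
  proof (induction S rule: finite_induct)
    case empty
    then show ?case using assms by simp
  next
    case (insert i S)
    then obtain y where y: "psd (X - (\<Sum>k\<in>S. outer (y k)))"
      "\<And>k j. k \<in> S \<Longrightarrow> (X - (\<Sum>k\<in>S. outer (y k))) $ k $ j = 0"
      by blast
    let ?R = "X - (\<Sum>k\<in>S. outer (y k))"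
    from psd_eliminate_index[OF y(1), of i] obtain z where z: "psd (?R - outer z)"
      "\<And>j. (?R - outer z) $ i $ j = 0" "\<And>k. (\<And>j. ?R $ k $ j = 0) \<Longrightarrow> z $ k = 0"
      by metis
    have "(\<Sum>k\<in>S. outer ((y(i := z)) k)) = (\<Sum>k\<in>S. outer (y k))"
      using insert.hyps by (intro sum.cong) auto
    then have eq: "X - (\<Sum>k\<in>insert i S. outer ((y(i := z)) k)) = ?R - outer z"
      using insert.hyps by simp
    have "(?R - outer z) $ k $ j = 0" if "k \<in> S" for k j
    proof -
      have "z $ k = 0" using z(3) y(2)[OF that] by blast
      moreover have "(?R - outer z) $ k $ j = ?R $ k $ j - outer z $ k $ j" by simp
      ultimately show ?thesis using y(2)[OF that, of j] by (simp add: outer_def)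
    qed
    with z show ?case
      by (intro exI[of _ "y(i := z)"]) (unfold eq, auto)
  qed
  from this[of UNIV, OF finite] obtain y :: "'n \<Rightarrow> complex^'n" where "\<And>i j. (X - (\<Sum>k\<in>UNIV. outer (y k))) $ i $ j = 0"
    by blast
  then have "X - (\<Sum>k\<in>UNIV. outer (y k)) = 0"
    unfolding vec_eq_iff by simp
  then show thesis using that by simp
qed

section \<open>Convexity of the numerical range\<close>

lemma quad_form_div_norm_in_numerical_range:
  assumes "z \<noteq> 0"
  shows "quad_form C z / of_real ((norm z)\<^sup>2) \<in> numerical_range C"
proof -
  let ?c = "of_real (1 / norm z) :: complex"
  have "norm (?c *s z) = 1"
    using assms by (simp add: norm_scale_vec norm_divide)
  moreover have "quad_form C (?c *s z) = quad_form C z / of_real ((norm z)\<^sup>2)"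
    by (simp add: quad_form_scale norm_divide power_divide)
  ultimately show ?thesis
    unfolding numerical_range_def by force
qed

lemma continuous_on_norm_path:
  "continuous_on S (\<lambda>t::real. norm (of_real (1 - t) *s x + of_real t *s (y::complex^'n)))"
  unfolding norm_vec_def L2_set_def by (simp, intro continuous_intros)

text \<open>
  The Toeplitz--Hausdorff theorem.  Given points \<open>p \<noteq> r\<close> attained at unit vectors \<open>x\<close> and \<open>y\<close>,
  the affine map taking \<open>p\<close> to \<open>0\<close> and \<open>r\<close> to \<open>1\<close> replaces the form of \<open>C\<close> by the form \<open>B\<close>
  below.  Multiplying \<open>y\<close> by a phase makes the sum of the two cross terms of \<open>B\<close> real, so
  the Rayleigh quotient of \<open>B\<close> along the segment from \<open>x\<close> to \<open>y\<close> is a continuous real function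
  from \<open>0\<close> to \<open>1\<close>, and the intermediate value theorem reaches every point between.
\<close>

theorem convex_numerical_range: "convex (numerical_range C)"
proof (rule convexI)
  fix p r :: complex and a t :: real
  assume p: "p \<in> numerical_range C" and r: "r \<in> numerical_range C"
    and t: "0 \<le> a" "0 \<le> t" "a + t = 1"
  obtain x where x: "norm x = 1" "quad_form C x = p"
    using p by (auto simp: numerical_range_def)
  obtain y' where y': "norm y' = 1" "quad_form C y' = r"
    using r by (auto simp: numerical_range_def)
  show "a *\<^sub>R p + t *\<^sub>R r \<in> numerical_range C"
  proof (cases "p = r")
    case True
    then show ?thesis using p t by (simp flip: scaleR_add_left)
  next
    case False
    have N: "sesq_form (mat 1) z z = of_real ((norm z)\<^sup>2)" for z :: "complex^'a"
      unfolding norm_vec_complex_square of_real_sum complex_norm_square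
      by (simp add: sesq_form_def mult.commute)
    define B where "B z w = (sesq_form C z w - p * sesq_form (mat 1) z w) / (r - p)" for z w
    have B_simps: "B (z + z') w = B z w + B z' w" "B z (w + w') = B z w + B z w'"
      "B (c *s z) w = cnj c * B z w" "B z (c *s w) = c * B z w" for z z' w w' c
      unfolding B_def sesq_form_simps
      by (simp_all add: add_divide_distrib diff_divide_distrib ring_distribs mult.left_commute)
    \<comment> \<open>With \<open>y = c y'\<close> the cross terms are \<open>c B(x,y') + cnj c B(y',x)\<close>, whose imaginary part is that
        of \<open>c e\<close>; hence \<open>c\<close> is the phase that turns \<open>e\<close> into its modulus.\<close>
    define e where "e = B x y' - cnj (B y' x)"
    define c where "c = (if e = 0 then 1 else cnj e / of_real (cmod e))"
    have c1: "cmod c = 1" by (simp add: c_def norm_divide)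
    have ce: "Im (c * e) = 0"
    proof (cases "e = 0")
      case False
      have "c * e = (e * cnj e) / of_real (cmod e)" using False by (simp add: c_def)
      also have "\<dots> = of_real ((cmod e)\<^sup>2 / cmod e)" by (simp only: complex_norm_square[symmetric] of_real_divide)
      finally show ?thesis by simp
    qed simp
    define y where "y = c *s y'"
    have y: "norm y = 1" "quad_form C y = r"
      using y' c1 by (simp_all add: y_def norm_scale_vec quad_form_scale)
    have cross: "Im (B x y + B y x) = 0"
    proof -
      have "Im (B x y + B y x) = Im (c * e)"
        unfolding y_def B_simps e_def by (simp add: algebra_simps)
      then show ?thesis using ce by simp
    qed
    have Bx: "B x x = 0" and By: "B y y = 1"
      using x y False unfolding B_def N quad_form_eq_sesq_form by auto
    define z where "z s = of_real (1 - s) *s x + of_real s *s y" for s :: real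
    have Bz: "Im (B (z s) (z s)) = 0" for s
    proof -
      have "B (z s) (z s) = of_real ((1 - s) * s) * (B x y + B y x) + of_real (s\<^sup>2)"
        unfolding z_def B_simps Bx By by (simp add: algebra_simps power2_eq_square)
      then show ?thesis using cross by simp
    qed
    \<comment> \<open>The segment avoids the origin: otherwise \<open>x\<close> and \<open>y\<close> would differ by a sign, and the form
        of \<open>C\<close> would agree on them.\<close>
    have z0: "z s \<noteq> 0" for s
    proof
      assume "z s = 0"
      then have eq: "of_real (1 - s) *s x = of_real (- s) *s y"
        by (simp add: z_def vec_eq_iff eq_neg_iff_add_eq_0)
      from arg_cong[OF this, of norm] x y have "\<bar>1 - s\<bar> = \<bar>s\<bar>"
        by (simp only: norm_scale_vec norm_of_real) simp
      then have "s = 1/2" by (simp add: abs_if split: if_splits)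
      with arg_cong[OF eq, of "quad_form C"] x y False show False
        by (simp only: quad_form_scale norm_of_real) simp
    qed
    define f where "f s = Re (B (z s) (z s)) / (norm (z s))\<^sup>2" for s
    have contB: "continuous_on {0..1} (\<lambda>s. B (z s) (z s))"
      unfolding z_def B_simps using False by (intro continuous_intros)
    have contN: "continuous_on {0..1} (\<lambda>s. norm (z s))"
      unfolding z_def by (rule continuous_on_norm_path)
    have "continuous_on {0..1} f"
      unfolding f_def using z0
      by (intro continuous_on_divide continuous_on_Re contB continuous_on_power contN) simp
    moreover have "f 0 = 0" "f 1 = 1"
      by (simp_all add: f_def z_def Bx By y)
    ultimately obtain s where s: "f s = t"
      using IVT'[of f 0 t 1] t by auto
    have "B (z s) (z s) = of_real (t * (norm (z s))\<^sup>2)"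
      using s Bz[of s] z0[of s] by (simp add: complex_eq_iff f_def field_simps)
    then have "quad_form C (z s) / of_real ((norm (z s))\<^sup>2) = p + of_real t * (r - p)"
      using z0[of s] False unfolding B_def N quad_form_eq_sesq_form
      by (simp add: field_simps)
    moreover have "p + of_real t * (r - p) = a *\<^sub>R p + t *\<^sub>R r"
    proof -
      have a: "a = 1 - t" using t by simp
      show ?thesis unfolding a by (simp add: scaleR_conv_of_real algebra_simps)
    qed
    ultimately show ?thesis
      using quad_form_div_norm_in_numerical_range[OF z0[of s], of C] by simp
  qed
qed

text \<open>
  After writing \<open>X\<close> as a sum of rank-one matrices \<open>y y\<^sup>*\<close>, the trace is the convex combination
  of the Rayleigh quotients of \<open>C\<close> at the vectors \<open>y\<close> with weights \<open>\<parallel>y\<parallel>\<^sup>2\<close>.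
\<close>

theorem trace_density_in_numerical_range:
  fixes C X :: "complex^'n^'n"
  assumes "psd X" and "trace X = 1"
  shows "trace (C ** X) \<in> numerical_range C"
proof -
  obtain y :: "'n \<Rightarrow> complex^'n" where X: "X = (\<Sum>k\<in>UNIV. outer (y k))"
    using psd_eq_sum_outer[OF assms(1)] by blast
  have trC: "trace (F ** X) = (\<Sum>k\<in>UNIV. quad_form F (y k))" for F
  proof -
    have "F ** (\<Sum>k\<in>S. outer (y k)) = (\<Sum>k\<in>S. F ** outer (y k))" for S
      by (induction S rule: infinite_finite_induct) (simp_all add: matrix_add_ldistrib)
    moreover have "trace (\<Sum>k\<in>S. G k) = (\<Sum>k\<in>S. trace (G k))" for S and G :: "'n \<Rightarrow> complex^'n^'n"
      by (induction S rule: infinite_finite_induct) (simp_all add: trace_def sum.distrib)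
    ultimately show ?thesis by (simp add: X trace_mult_outer)
  qed
  have "complex_of_real (\<Sum>k\<in>UNIV. (norm (y k))\<^sup>2) = 1"
  proof -
    have "trace X = (\<Sum>k\<in>UNIV. trace (outer (y k)))"
      using trC[of "mat 1"] unfolding trace_mult_outer[symmetric] matrix_mul_lid .
    then show ?thesis using assms(2) by (simp add: trace_outer)
  qed
  then have wsum: "(\<Sum>k\<in>UNIV. (norm (y k))\<^sup>2) = 1"
    by (simp only: of_real_eq_1_iff)
  obtain x0 :: "complex^'n" where x0: "x0 \<noteq> 0"
    using axis_eq_0_iff[of undefined "1::complex"] by force
  \<comment> \<open>A vanishing summand has weight zero, but still needs some point of the numerical range.\<close>
  define g where "g k = (if y k = 0 then x0 else y k)" for k
  define p where "p k = quad_form C (g k) / of_real ((norm (g k))\<^sup>2)" for k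
  have "p k \<in> numerical_range C" for k
    unfolding p_def using x0 by (intro quad_form_div_norm_in_numerical_range) (simp add: g_def)
  then have "(\<Sum>k\<in>UNIV. (norm (y k))\<^sup>2 *\<^sub>R p k) \<in> numerical_range C"
    using wsum by (intro convex_sum[OF _ convex_numerical_range]) auto
  moreover have "(norm (y k))\<^sup>2 *\<^sub>R p k = quad_form C (y k)" for k
    by (simp add: p_def g_def scaleR_conv_of_real quad_form_def)
  ultimately show ?thesis by (simp add: trC)
qed

section \<open>The two-by-two semidefinite constraint\<close>

lemma quad_form_sym2:
  "quad_form (sym2 u v w) x =
    of_real (u * (cmod (x $ 1))\<^sup>2 + 2 * v * Re (cnj (x $ 1) * x $ 2) + w * (cmod (x $ 2))\<^sup>2)"
proof -
  have "quad_form (sym2 u v w) x = of_real u * (x $ 1 * cnj (x $ 1))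
      + of_real v * (cnj (x $ 1) * x $ 2 + cnj (cnj (x $ 1) * x $ 2)) + of_real w * (x $ 2 * cnj (x $ 2))"
    by (simp add: quad_form_def matrix_vector_mult_def sum_2 sym2_def algebra_simps)
  then show ?thesis
    by (simp only: complex_add_cnj complex_norm_square[symmetric]) simp
qed

text \<open>
  Writing the matrix as \<open>m I\<close> plus the traceless matrix with rows \<open>(a, v)\<close> and \<open>(v, -a)\<close>, the
  smallest eigenvalue is \<open>m - r\<close> with \<open>r\<^sup>2 = a\<^sup>2 + v\<^sup>2\<close>.  For the forward direction the form is
  evaluated at an eigenvector for it; for the converse, \<open>r \<le> m\<close> gives nonnegative diagonal
  entries with \<open>v\<^sup>2 \<le> u w\<close>, and the form dominates a square.
\<close>

lemma psd_sym2_iff: "psd (sym2 u v w) \<longleftrightarrow> sqrt (((u - w) / 2)\<^sup>2 + v\<^sup>2) \<le> (u + w) / 2"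
proof
  define a where "a = (u - w) / 2"
  define m where "m = (u + w) / 2"
  define r where "r = sqrt (a\<^sup>2 + v\<^sup>2)"
  have u: "u = m + a" and w: "w = m - a" by (simp_all add: a_def m_def field_simps)
  have r2: "r\<^sup>2 = a\<^sup>2 + v\<^sup>2" and r0: "0 \<le> r" by (simp_all add: r_def)
  {
    assume psd: "psd (sym2 u v w)"
    have real_form: "0 \<le> u * p\<^sup>2 + 2 * v * (p * q) + w * q\<^sup>2" for p q
    proof -
      let ?x = "vector [of_real p, of_real q] :: complex^2"
      have "quad_form (sym2 u v w) ?x \<in> \<real>\<^sub>\<ge>\<^sub>0"
        using psd by (simp add: psd_def)
      then show ?thesis
        unfolding quad_form_sym2 nonneg_Reals_of_real_iff by simp
    qed
    have "r \<le> m"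
    \<comment> \<open>The eigenvector is \<open>(v, -(a + r))\<close>, unless this is zero; then it is \<open>(1, 0)\<close>.\<close>
    proof (cases "v = 0 \<and> a + r = 0")
      case True
      then show ?thesis using real_form[of 1 0] u by simp
    next
      case False
      have "u * v\<^sup>2 + 2 * v * (v * - (a + r)) + w * (- (a + r))\<^sup>2
          = m * (v\<^sup>2 + (a + r)\<^sup>2) + (a * v\<^sup>2 - 2 * v\<^sup>2 * (a + r) - a * (a + r)\<^sup>2)"
        unfolding u w by (simp add: algebra_simps power2_eq_square)
      also have "a * v\<^sup>2 - 2 * v\<^sup>2 * (a + r) - a * (a + r)\<^sup>2 = - r * (v\<^sup>2 + (a + r)\<^sup>2)"
        using r2 by algebra
      finally have "0 \<le> (m - r) * (v\<^sup>2 + (a + r)\<^sup>2)"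
        using real_form[of v "- (a + r)"] by (simp add: algebra_simps)
      moreover have "0 < v\<^sup>2 + (a + r)\<^sup>2"
        using False by (simp add: sum_power2_gt_zero_iff)
      ultimately show ?thesis by (simp add: zero_le_mult_iff)
    qed
    then show "sqrt (((u - w) / 2)\<^sup>2 + v\<^sup>2) \<le> (u + w) / 2"
      by (simp add: r_def a_def m_def)
  }
  assume "sqrt (((u - w) / 2)\<^sup>2 + v\<^sup>2) \<le> (u + w) / 2"
  then have rm: "r \<le> m" by (simp add: r_def a_def m_def)
  have ar: "\<bar>a\<bar> \<le> r" using real_sqrt_sum_squares_ge1[of a v] by (simp add: r_def abs_le_iff real_le_rsqrt)
  have u0: "0 \<le> u" and w0: "0 \<le> w" using ar rm u w by auto
  have "v\<^sup>2 \<le> u * w"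
  proof -
    have "r\<^sup>2 \<le> m\<^sup>2" using rm r0 by (intro power_mono) auto
    then show ?thesis using r2 unfolding u w by (simp add: algebra_simps power2_eq_square)
  qed
  then have v: "\<bar>v\<bar> \<le> sqrt u * sqrt w"
    by (metis real_sqrt_abs real_sqrt_le_mono real_sqrt_mult)
  show "psd (sym2 u v w)"
    unfolding psd_def
  proof (intro conjI allI)
    show "hermitian (sym2 u v w)"
      by (simp add: hermitian_entry forall_2 sym2_def)
    fix x :: "complex^2"
    have "\<bar>v * Re (cnj (x $ 1) * x $ 2)\<bar> \<le> (sqrt u * sqrt w) * (cmod (x $ 1) * cmod (x $ 2))"
      unfolding abs_mult using v abs_Re_le_cmod[of "cnj (x $ 1) * x $ 2"]
      by (intro mult_mono) (auto simp: norm_mult u0 w0)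
    moreover have "0 \<le> (sqrt u * cmod (x $ 1) - sqrt w * cmod (x $ 2))\<^sup>2" by simp
    then have "2 * ((sqrt u * sqrt w) * (cmod (x $ 1) * cmod (x $ 2)))
        \<le> u * (cmod (x $ 1))\<^sup>2 + w * (cmod (x $ 2))\<^sup>2"
      using u0 w0 by (simp add: power2_diff power_mult_distrib algebra_simps)
    ultimately show "quad_form (sym2 u v w) x \<in> \<real>\<^sub>\<ge>\<^sub>0"
      unfolding quad_form_sym2 nonneg_Reals_of_real_iff by linarith
  qed
qed

section \<open>The semidefinite program\<close>

lemma trace_cartesian_decomposition:
  assumes "hermitian A" "hermitian B" "hermitian X"
  shows "trace ((A + map_matrix (\<lambda>z. \<i> * z) B) ** X) = Complex (trace_inner A X) (trace_inner B X)"
proof -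
  have "trace ((A + map_matrix (\<lambda>z. \<i> * z) B) ** X) = trace (A ** X) + \<i> * trace (B ** X)"
    by (simp add: trace_def matrix_matrix_mult_def map_matrix_def algebra_simps sum.distrib
        sum_distrib_left)
  then show ?thesis
    using assms by (simp add: of_real_trace_inner[symmetric] complex_eq_iff)
qed

theorem theorem1:
  fixes A B C :: "complex^'n^'n"
  assumes "hermitian A" and "hermitian B"
    and "C = A + map_matrix (\<lambda>z. \<i> * z) B"
  shows "is_minimum (crawford_number C)
    {(u + w) / 2 | (u :: real) (v :: real) (w :: real) (X :: complex^'n^'n).
       (u - w) / 2 - trace_inner A X = 0 \<and>
       v - trace_inner B X = 0 \<and>
       trace_inner (mat 1) X = 1 \<and>
       psd X \<and>
       psd (sym2 u v w)}"
proof -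
  let ?m = "crawford_number C"
  have trC: "trace (C ** X) = Complex (trace_inner A X) (trace_inner B X)" if "psd X" for X
    using that assms by (simp add: trace_cartesian_decomposition psd_def)
  have tr1: "trace X = of_real (trace_inner (mat 1) X)" if "psd X" for X :: "complex^'n^'n"
  proof -
    have "hermitian (mat 1 :: complex^'n^'n)" by (simp add: hermitian_entry mat_def)
    then show ?thesis
      using that of_real_trace_inner[of "mat 1" X] by (simp add: psd_def)
  qed
  have min: "?m \<in> cmod ` numerical_range C" "\<And>z. z \<in> numerical_range C \<Longrightarrow> ?m \<le> cmod z"
    using crawford_number_is_minimum[of C] by (auto simp: is_minimum_def)
  show ?thesis
    unfolding is_minimum_def
  proof (intro conjI ballI)
    obtain x where x: "norm x = 1" "?m = cmod (quad_form C x)"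
      using min(1) by (auto simp: numerical_range_def)
    \<comment> \<open>The rank-one density matrix of a minimiser, with \<open>u\<close> and \<open>w\<close> solved from their prescribed
        half sum \<open>\<chi>(C)\<close> and half difference \<open>a\<close>; the \<open>2\<times>2\<close> matrix is then singular.\<close>
    define X where "X = outer x"
    have X: "psd X" by (simp add: X_def psd_outer)
    define a where "a = trace_inner A X"
    define b where "b = trace_inner B X"
    have "?m = sqrt (a\<^sup>2 + b\<^sup>2)"
      using trC[OF X] x by (simp add: X_def trace_mult_outer a_def b_def complex_norm)
    then have "psd (sym2 (?m + a) b (?m - a))"
      by (simp add: psd_sym2_iff)
    moreover have "trace_inner (mat 1) X = 1"
      using tr1[OF X] x by (simp add: X_def trace_outer)
    ultimately show "?m \<in> {(u + w) / 2 | (u :: real) (v :: real) (w :: real) (X :: complex^'n^'n).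
       (u - w) / 2 - trace_inner A X = 0 \<and> v - trace_inner B X = 0 \<and>
       trace_inner (mat 1) X = 1 \<and> psd X \<and> psd (sym2 u v w)}"
      using X by (intro CollectI exI[of _ "?m + a"] exI[of _ b] exI[of _ "?m - a"] exI[of _ X])
        (simp add: a_def b_def)
  next
    fix s
    assume "s \<in> {(u + w) / 2 | (u :: real) (v :: real) (w :: real) (X :: complex^'n^'n).
       (u - w) / 2 - trace_inner A X = 0 \<and> v - trace_inner B X = 0 \<and>
       trace_inner (mat 1) X = 1 \<and> psd X \<and> psd (sym2 u v w)}"
    then obtain u v w X where s: "s = (u + w) / 2"
      and ab: "(u - w) / 2 = trace_inner A X" "v = trace_inner B X"
      and X: "trace_inner (mat 1) X = 1" "psd X" and uvw: "psd (sym2 u v w)"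
      by auto
    have "?m \<le> cmod (trace (C ** X))"
      using X tr1 by (intro min(2) trace_density_in_numerical_range) auto
    also have "\<dots> = sqrt (((u - w) / 2)\<^sup>2 + v\<^sup>2)"
      by (simp add: trC X ab complex_norm)
    also have "\<dots> \<le> s"
      using uvw by (simp add: psd_sym2_iff s)
    finally show "?m \<le> s" .
  qed
qed

end
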